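(* Let $1<p<\infty$ and $0<\gamma<1$. If $\{A_i\}_{i=1}^\infty$ is a sequence of sets in $X$, then $$\mathcal{C}_{\gamma,p}\Big(\liminf_{i\to\infty}A_i\Big)\le\liminf_{i\to\infty}\mathcal{C}_{\gamma,p}(A_i),$$ where $\liminf_{i\to\infty}A_i=\bigcup_{j\ge1}\bigcap_{k\ge j}A_k$.
   Context: Setting: $X=(X,d,\mu)$ is a locally compact metric space equipped with a Borel regular outer measure $\mu$ that is doubling, i.e. there is a constant $c_d\ge 1$ with $\mu(B(x,2r))\le c_d\,\mu(B(x,r))$ for every ball $B(x,r)=\{y\in X: d(y,x)<r\}$. Every open ball has positive and finite measure. Spheres have measure zero, $\mu(\{y\in X: d(x,y)=r\})=0$ for all $x\in X$, $r>0$, and points have measure zero, $\mu(\{x\})=0$ for all $x\in X$. For $0<\gamma<1$, the Riesz potential of order $\gamma$ of a measurable function $f$ is $$I_\gamma f(x)=\int_X \frac{f(y)}{\mu(B(x,d(x,y)))^{1-\gamma}}\,d\mu(y)$$ (the single point $y=x$ may be omitted from the domain of integration, since it is $\mu$-null). $L^p_+(X)$ denotes the set of non-negative functions in $L^p(X)=L^p(X,\mu)$. For $1<p<\infty$ and any $E\subset X$, the Riesz $(\gamma,p)$-capacity is $\mathcal{C}_{\gamma,p}(E)=\inf_{f\in\mathcal{A}(E)}\|f\|_{L^p(X)}^p$, where $\mathcal{A}(E)=\{f\in L^p_+(X): I_\gamma f\ge 1\text{ on }E\}$ and $\mathcal{C}_{\gamma,p}(E)=\infty$ if $\mathcal{A}(E)=\emptyset$.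 *)

theory Defs
  imports "HOL-Analysis.Analysis"
begin

definition caratheodory_measure :: "('a set \<Rightarrow> ennreal) \<Rightarrow> 'a measure" where
  "caratheodory_measure \<mu> = measure_of UNIV (lambda_system UNIV UNIV \<mu>) \<mu>"

text \<open>
  As usual, the \<open>\<mu>\<close>-measurable sets are those satisfying the Caratheodory condition, and
  integrals with respect to the outer measure \<open>\<mu>\<close> are integrals with respect to its restriction
  to them. The next lemma checks that this restriction is not degenerate.
\<close>

lemma
  fixes \<mu> :: "'a set \<Rightarrow> ennreal"
  assumes "outer_measure_space UNIV \<mu>"
  shows space_caratheodory_measure: "space (caratheodory_measure \<mu>) = UNIV"
    and sets_caratheodory_measure:
      "sets (caratheodory_measure \<mu>) = lambda_system UNIV UNIV \<mu>"
    and emeasure_caratheodory_measure: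
      "S \<in> lambda_system UNIV UNIV \<mu> \<Longrightarrow> emeasure (caratheodory_measure \<mu>) S = \<mu> S"
proof -
  have "sigma_algebra (UNIV :: 'a set) UNIV"
    using sigma_algebra_Pow[of "UNIV :: 'a set"] by simp
  then have ms: "measure_space UNIV (lambda_system UNIV UNIV \<mu>) \<mu>"
    using assms by (rule sigma_algebra.caratheodory_lemma)
  then have sa: "sigma_algebra UNIV (lambda_system UNIV UNIV \<mu>)"
    by (simp add: measure_space_def)
  show "space (caratheodory_measure \<mu>) = UNIV"
    by (simp add: caratheodory_measure_def space_measure_of_conv)
  show sets: "sets (caratheodory_measure \<mu>) = lambda_system UNIV UNIV \<mu>"
    by (simp add: caratheodory_measure_def sigma_algebra.sigma_sets_eq[OF sa])
  show "emeasure (caratheodory_measure \<mu>) S = \<mu> S" if "S \<in> lambda_system UNIV UNIV \<mu>"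
    using ms that sets
    by (intro emeasure_measure_of[OF caratheodory_measure_def])
       (auto simp: measure_space_def)
qed

definition borel_regular_outer_measure :: "('a::topological_space set \<Rightarrow> ennreal) \<Rightarrow> bool" where
  "borel_regular_outer_measure \<mu> \<longleftrightarrow>
     outer_measure_space UNIV \<mu> \<and>
     sets borel \<subseteq> lambda_system UNIV UNIV \<mu> \<and>
     (\<forall>S. \<exists>B\<in>sets borel. S \<subseteq> B \<and> \<mu> B = \<mu> S)"

text \<open>The underlying metric space is the whole type \<open>'a\<close>.\<close>

locale doubling_space =
  fixes \<mu> :: "'a::metric_space set \<Rightarrow> ennreal"
  assumes locally_compact: "locally_compact_space (euclidean :: 'a topology)"
    and borel_regular: "borel_regular_outer_measure \<mu>"
    and doubling: "\<exists>c::real. c \<ge> 1 \<and> (\<forall>x r. r > 0 \<longrightarrow> \<mu> (ball x (2 * r)) \<le> ennreal c * \<mu> (ball x r))"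
    and ball_pos: "r > 0 \<Longrightarrow> 0 < \<mu> (ball x r)"
    and ball_finite: "r > 0 \<Longrightarrow> \<mu> (ball x r) < \<infinity>"
    and sphere_null: "r > 0 \<Longrightarrow> \<mu> (sphere x r) = 0"
    and point_null: "\<mu> {x} = 0"

text \<open>
  The potential is only needed for \<open>f \<ge> 0\<close>, where it takes values in \<open>[0, \<infinity>]\<close>; negative
  values of \<open>f\<close> would be truncated to \<open>0\<close>. The point \<open>y = x\<close> is omitted since \<open>ball x 0\<close>
  is empty.
\<close>

definition riesz_potential ::
    "('a::metric_space set \<Rightarrow> ennreal) \<Rightarrow> real \<Rightarrow> ('a \<Rightarrow> real) \<Rightarrow> 'a \<Rightarrow> ennreal" where
  "riesz_potential \<mu> \<gamma> f x =
     (\<integral>\<^sup>+ y \<in> UNIV - {x}. ennreal (f y / enn2real (\<mu> (ball x (dist x y))) powr (1 - \<gamma>))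
        \<partial>caratheodory_measure \<mu>)"

definition Lp_nonneg :: "'a measure \<Rightarrow> real \<Rightarrow> ('a \<Rightarrow> real) set" where
  "Lp_nonneg M p =
     {f \<in> borel_measurable M. (\<forall>x. 0 \<le> f x) \<and> integrable M (\<lambda>x. \<bar>f x\<bar> powr p)}"

definition Lp_norm :: "'a measure \<Rightarrow> real \<Rightarrow> ('a \<Rightarrow> real) \<Rightarrow> real" where
  "Lp_norm M p f = (\<integral>x. \<bar>f x\<bar> powr p \<partial>M) powr (1 / p)"

definition riesz_admissible ::
    "('a::metric_space set \<Rightarrow> ennreal) \<Rightarrow> real \<Rightarrow> real \<Rightarrow> 'a set \<Rightarrow> ('a \<Rightarrow> real) set" where
  "riesz_admissible \<mu> \<gamma> p E =
     {f \<in> Lp_nonneg (caratheodory_measure \<mu>) p. \<forall>x\<in>E. riesz_potential \<mu> \<gamma> f x \<ge> 1}"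

text \<open>The infimum over the empty set in \<open>ennreal\<close> is \<open>\<infinity>\<close>.\<close>

definition riesz_capacity ::
    "('a::metric_space set \<Rightarrow> ennreal) \<Rightarrow> real \<Rightarrow> real \<Rightarrow> 'a set \<Rightarrow> ennreal" where
  "riesz_capacity \<mu> \<gamma> p E =
     (INF f \<in> riesz_admissible \<mu> \<gamma> p E. ennreal (Lp_norm (caratheodory_measure \<mu>) p f powr p))"

end

theory Submission
  imports Defs
begin

text \<open>
  The sets \<open>\<Inter>k\<ge>j. A k\<close> increase with \<open>j\<close>, and each has capacity at most \<open>C (A k)\<close> for all
  \<open>k \<ge> j\<close>. So everything rests on continuity of the capacity along increasing sets:
  \<open>C (\<Union>n. E n) \<le> L\<close>, where \<open>L\<close> is the supremum of the \<open>C (E n)\<close> (\<open>riesz_capacity_incseq_Union\<close>).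

  Let \<open>L < \<infinity>\<close> and choose \<open>u n\<close> admissible for \<open>E n\<close> with \<open>\<integral>(u n)\<^sup>p\<close> almost minimal. For \<open>i \<le> j\<close> the
  midpoint of \<open>u i\<close> and \<open>u j\<close> is still admissible for \<open>E i\<close>, because the potential is linear;
  hence its \<open>p\<close>-th power has integral at least \<open>C (E i)\<close>, which is close to the integrals of
  \<open>(u i)\<^sup>p\<close> and \<open>(u j)\<^sup>p\<close> when \<open>i\<close> is large. Uniform convexity of \<open>t \<mapsto> t\<^sup>p\<close>, in the pointwise form
  \<open>abs_powr_diff_le_midpoint_gap\<close>, turns this into the statement that the powers \<open>(u n)\<^sup>p\<close> are
  Cauchy in \<open>L\<^sup>1\<close>. Working with the powers rather than with \<open>u n\<close> in \<open>L\<^sup>p\<close> reduces everything to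
  integrals of non-negative functions.

  The potential is monotone, so no limit of potentials has to be identified: a fast
  subsequence of the \<open>(u n)\<^sup>p\<close> lies below its first member plus the sum of the absolute
  increments, and the \<open>p\<close>-th root \<open>g\<close> of that majorant satisfies \<open>\<integral>g\<^sup>p \<le> L + d\<close>
  (\<open>minimising_sequence_dominated\<close>). Since \<open>g\<close> dominates infinitely many \<open>u n\<close> almost everywhere,
  its potential is at least 1 at every point of every \<open>E n\<close>. Thus \<open>g\<close> is admissible for the
  union, without any exceptional set.
\<close>

section \<open>Uniform convexity of the power function\<close>

lemma midpoint_powr_gap_strict_antimono:
  fixes p s t :: real
  assumes p: "1 < p" and st: "0 \<le> s" "s < t" "t \<le> 1"
  shows "(1 + t powr p) / 2 - ((1 + t) / 2) powr p < (1 + s powr p) / 2 - ((1 + s) / 2) powr p"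
proof (rule DERIV_neg_imp_decreasing_open[OF st(2)])
  fix x assume x: "s < x" "x < t"
  have "x powr (p - 1) < ((1 + x) / 2) powr (p - 1)"
    using x st p by (intro powr_less_mono2) auto
  then have "p * x powr (p - 1) < p * ((1 + x) / 2) powr (p - 1)"
    using p by simp
  moreover have "((\<lambda>t. (1 + t powr p) / 2 - ((1 + t) / 2) powr p) has_real_derivative
      p * x powr (p - 1) / 2 - p * ((1 + x) / 2) powr (p - 1) / 2) (at x)"
    using x st by (auto intro!: derivative_eq_intros)
  ultimately show "\<exists>y. ((\<lambda>t. (1 + t powr p) / 2 - ((1 + t) / 2) powr p)
      has_real_derivative y) (at x) \<and> y < 0"
    by (intro exI conjI) auto
next
  show "continuous_on {s..t} (\<lambda>t. (1 + t powr p) / 2 - ((1 + t) / 2) powr p)"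
    using p st by (intro continuous_on_powr' continuous_intros) auto
qed

text \<open>
  Both sides are homogeneous of degree \<open>p\<close>, so the larger number may be taken to be 1
  and the smaller one \<open>t\<close>. If \<open>1 - t\<^sup>p\<close> is at most \<open>e\<close>, the first term suffices. Otherwise \<open>t\<close>
  is bounded away from 1, so the convexity gap is bounded away from 0 because it decreases in \<open>t\<close>,
  and a large multiple of it exceeds 1.
\<close>

lemma abs_powr_diff_le_midpoint_gap:
  fixes p e :: real
  assumes p: "1 < p" and e: "0 < e" "e < 1"
  obtains K where "0 < K"
    "\<And>a b. 0 \<le> a \<Longrightarrow> 0 \<le> b \<Longrightarrow>
      \<bar>a powr p - b powr p\<bar>
        \<le> e * (a powr p + b powr p) + K * ((a powr p + b powr p) / 2 - ((a + b) / 2) powr p)"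
proof -
  define gap where "gap = (\<lambda>t::real. (1 + t powr p) / 2 - ((1 + t) / 2) powr p)"
  have gap_less: "gap t < gap s" if "0 \<le> s" "s < t" "t \<le> 1" for s t
    using midpoint_powr_gap_strict_antimono[OF p that] by (simp add: gap_def)
  have gap_1: "gap 1 = 0" by (simp add: gap_def)
  have gap_nonneg: "0 \<le> gap t" if "0 \<le> t" "t \<le> 1" for t
    using gap_less[of t 1] that gap_1 by (cases "t = 1") auto
  \<comment> \<open>the point with \<open>1 - r\<^sup>p = e\<close>, where the two regimes meet\<close>
  define r where "r = (1 - e) powr (1 / p)"
  have r_powr: "r powr p = 1 - e"
    using p e by (simp add: r_def powr_powr)
  have r: "0 \<le> r" "r < 1"
    using p e powr_less_mono2[of "1 / p" "1 - e" 1] by (auto simp: r_def)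
  have gap_r: "0 < gap r"
    using gap_less[of r 1] r gap_1 by simp
  have normalised: "1 - t powr p \<le> e * (1 + t powr p) + 1 / gap r * gap t"
    if t: "0 \<le> t" "t \<le> 1" for t
  proof (cases "t \<le> r")
    case True
    then have "gap r \<le> gap t"
      using gap_less[of t r] t r by (cases "t = r") auto
    then have "1 \<le> 1 / gap r * gap t"
      using gap_r by simp
    moreover have "0 \<le> e * (1 + t powr p)" "0 \<le> t powr p"
      using e by auto
    ultimately show ?thesis by linarith
  next
    case False
    then have "r powr p \<le> t powr p"
      using p r by (intro powr_mono2) auto
    then have "1 - t powr p \<le> e"
      using r_powr by simp
    moreover have "0 \<le> e * t powr p" "0 \<le> 1 / gap r * gap t"
      using e gap_nonneg[OF t] gap_r by auto
    ultimately show ?thesis by (simp add: algebra_simps)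
  qed
  have ordered: "\<bar>a powr p - b powr p\<bar>
      \<le> e * (a powr p + b powr p) + 1 / gap r * ((a powr p + b powr p) / 2 - ((a + b) / 2) powr p)"
    if ab: "0 \<le> b" "b \<le> a" for a b
  proof (cases "a = 0")
    case True
    with ab have "b = 0" by simp
    with True show ?thesis by simp
  next
    case False
    with ab have a: "0 < a" by simp
    define t where "t = b / a"
    have t: "0 \<le> t" "t \<le> 1" and b: "b = a * t"
      using ab a by (auto simp: t_def)
    have bp: "b powr p = a powr p * t powr p"
      using a t by (simp add: b powr_mult)
    have "(a + b) / 2 = a * ((1 + t) / 2)"
      by (simp add: b algebra_simps)
    then have mp: "((a + b) / 2) powr p = a powr p * ((1 + t) / 2) powr p"
      using a t by (simp only: powr_mult)
    have "b powr p \<le> a powr p"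
      using ab p by (intro powr_mono2) auto
    then have "\<bar>a powr p - b powr p\<bar> = a powr p * (1 - t powr p)"
      by (simp add: bp algebra_simps)
    also have "\<dots> \<le> a powr p * (e * (1 + t powr p) + 1 / gap r * gap t)"
      using normalised[OF t] by (intro mult_left_mono) auto
    also have "a powr p * (e * (1 + t powr p) + K * gap t) = e * (a powr p + b powr p)
        + K * ((a powr p + b powr p) / 2 - ((a + b) / 2) powr p)" for K
      unfolding bp mp gap_def by (simp add: field_simps)
    finally show ?thesis .
  qed
  show ?thesis
  proof
    show "0 < 1 / gap r" using gap_r by simp
    fix a b :: real assume "0 \<le> a" "0 \<le> b"
    then show "\<bar>a powr p - b powr p\<bar>
      \<le> e * (a powr p + b powr p) + 1 / gap r * ((a powr p + b powr p) / 2 - ((a + b) / 2) powr p)"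
      using ordered[of a b] ordered[of b a]
      by (cases "a \<le> b") (auto simp: abs_minus_commute add.commute)
  qed
qed

section \<open>A common majorant for a minimising sequence\<close>

text \<open>
  Along a subsequence whose increments are summable in \<open>L\<^sup>1\<close> with total \<open>d\<close>, the first member plus
  all absolute increments dominates every member by telescoping. The construction behind
  the completeness of \<open>L\<^sup>1\<close> is used here for the majorant, not for the limit.
\<close>

lemma L1_Cauchy_subsequence_dominated:
  fixes F :: "nat \<Rightarrow> 'a \<Rightarrow> real"
  assumes int: "\<And>n. integrable M (F n)" and nonneg: "\<And>n x. 0 \<le> F n x"
    and Cauchy: "\<And>e. 0 < e \<Longrightarrow> \<exists>N. \<forall>i\<ge>N. \<forall>j\<ge>i. (\<integral>x. \<bar>F j x - F i x\<bar> \<partial>M) \<le> e"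
    and bound: "\<And>n. (\<integral>x. F n x \<partial>M) \<le> B" and d: "0 < d"
  obtains G where "integrable M G" "\<And>x. 0 \<le> G x" "(\<integral>x. G x \<partial>M) \<le> B + d"
    "\<And>m. \<exists>n\<ge>m. AE x in M. F n x \<le> G x"
proof -
  have "\<forall>k. \<exists>N. \<forall>i\<ge>N. \<forall>j\<ge>i. (\<integral>x. \<bar>F j x - F i x\<bar> \<partial>M) \<le> d * (1/2) ^ Suc k"
    by (intro allI Cauchy) (use d in simp)
  then obtain N where N:
    "\<And>k i j. N k \<le> i \<Longrightarrow> i \<le> j \<Longrightarrow> (\<integral>x. \<bar>F j x - F i x\<bar> \<partial>M) \<le> d * (1/2) ^ Suc k"
    by metis
  \<comment> \<open>partial sums make the thresholds increasing, and the summand \<open>k\<close> makes \<open>s\<close> unbounded\<close>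
  define s where "s k = k + (\<Sum>l\<le>k. N l)" for k
  have s_ge: "k \<le> s k" "s k \<le> s (Suc k)" for k
    by (auto simp: s_def)
  have N_s: "N k \<le> s k" for k
    using member_le_sum[of k "{..k}" N] by (simp add: s_def)
  have step: "(\<integral>x. \<bar>F (s (Suc k)) x - F (s k) x\<bar> \<partial>M) \<le> d * (1/2) ^ Suc k" for k
    using N[OF N_s s_ge(2)] .
  define H where "H x = ennreal (F (s 0) x) + (\<Sum>k. ennreal \<bar>F (s (Suc k)) x - F (s k) x\<bar>)" for x
  have meas[measurable]: "F n \<in> borel_measurable M" for n
    using int by auto
  have "0 \<le> (\<integral>x. F 0 x \<partial>M)" using nonneg by (intro Bochner_Integration.integral_nonneg)
  with bound[of 0] have B: "0 \<le> B" by linarith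
  have H_meas[measurable]: "H \<in> borel_measurable M"
    unfolding H_def by measurable
  have "(\<integral>\<^sup>+x. H x \<partial>M) = (\<integral>\<^sup>+x. ennreal (F (s 0) x) \<partial>M)
      + (\<Sum>k. \<integral>\<^sup>+x. ennreal \<bar>F (s (Suc k)) x - F (s k) x\<bar> \<partial>M)"
    unfolding H_def by (simp add: nn_integral_add nn_integral_suminf)
  also have "\<dots> \<le> ennreal B + (\<Sum>k. ennreal (d * (1/2) ^ Suc k))"
    using int nonneg bound step
    by (intro add_mono suminf_le) (auto simp: nn_integral_eq_integral intro!: ennreal_leI)
  also have "(\<Sum>k. ennreal (d * (1/2) ^ Suc k)) = ennreal d"
    using sums_mult[OF power_half_series, of d] d
    by (intro suminf_ennreal_eq) auto
  also have "ennreal B + ennreal d = ennreal (B + d)"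
    using B d by simp
  finally have H_int: "(\<integral>\<^sup>+x. H x \<partial>M) \<le> ennreal (B + d)" .
  have H_fin: "AE x in M. H x \<noteq> \<infinity>"
    using H_int by (intro nn_integral_PInf_AE) (auto simp: top_unique)
  have F_le_H: "ennreal (F (s n) x) \<le> H x" for n x
  proof -
    have "F (s n) x \<le> F (s 0) x + (\<Sum>k<n. \<bar>F (s (Suc k)) x - F (s k) x\<bar>)"
      by (induction n) (auto simp: abs_if)
    then have "ennreal (F (s n) x)
        \<le> ennreal (F (s 0) x) + (\<Sum>k<n. ennreal \<bar>F (s (Suc k)) x - F (s k) x\<bar>)"
      using nonneg by (subst sum_ennreal) (auto simp flip: ennreal_plus intro!: ennreal_leI simp: sum_nonneg)
    also have "\<dots> \<le> H x"
      unfolding H_def by (intro add_left_mono sum_le_suminf) auto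
    finally show ?thesis .
  qed
  \<comment> \<open>\<open>enn2real\<close> replaces the value \<open>\<infinity>\<close> by 0, hence the domination only almost everywhere\<close>
  show ?thesis
  proof
    have nn: "(\<integral>\<^sup>+x. ennreal (enn2real (H x)) \<partial>M) = (\<integral>\<^sup>+x. H x \<partial>M)"
      using H_fin by (intro nn_integral_cong_AE) (auto simp: less_top)
    show i: "integrable M (\<lambda>x. enn2real (H x))"
      using le_less_trans[OF H_int ennreal_less_top] by (intro integrableI_nonneg) (auto simp: nn)
    show "(\<integral>x. enn2real (H x) \<partial>M) \<le> B + d"
      using H_int nn_integral_eq_integral[OF i] B d
      by (subst ennreal_le_iff[symmetric]) (auto simp: nn)
    fix m
    have "AE x in M. F (s m) x \<le> enn2real (H x)"
      using H_fin
    proof eventually_elim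
      case (elim x)
      then show ?case
        using enn2real_mono[OF F_le_H[of m x]] nonneg by (simp add: less_top)
    qed
    with s_ge(1)[of m] show "\<exists>n\<ge>m. AE x in M. F n x \<le> enn2real (H x)" by blast
  qed simp
qed

lemma Lp_nonnegD:
  assumes "f \<in> Lp_nonneg M p"
  shows "f \<in> borel_measurable M" "0 \<le> f x" "integrable M (\<lambda>x. f x powr p)"
  using assms by (auto simp: Lp_nonneg_def)

lemma Lp_nonnegI:
  assumes "f \<in> borel_measurable M" "\<And>x. 0 \<le> f x" "integrable M (\<lambda>x. f x powr p)"
  shows "f \<in> Lp_nonneg M p"
  using assms by (auto simp: Lp_nonneg_def)

lemma Lp_norm_powr:
  assumes "f \<in> Lp_nonneg M p" "p \<noteq> 0"
  shows "Lp_norm M p f powr p = (\<integral>x. f x powr p \<partial>M)"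
  using assms by (auto simp: Lp_norm_def powr_powr Lp_nonneg_def intro!: Bochner_Integration.integral_cong)

lemma midpoint_in_Lp_nonneg:
  assumes f: "f \<in> Lp_nonneg M p" and g: "g \<in> Lp_nonneg M p" and p: "0 \<le> p"
  shows "(\<lambda>x. (f x + g x) / 2) \<in> Lp_nonneg M p"
proof (rule Lp_nonnegI)
  note [measurable] = Lp_nonnegD(1)[OF f] Lp_nonnegD(1)[OF g]
  show "(\<lambda>x. (f x + g x) / 2) \<in> borel_measurable M" by measurable
  show "0 \<le> (f x + g x) / 2" for x
    using Lp_nonnegD(2)[OF f] Lp_nonnegD(2)[OF g] by simp
  have "((f x + g x) / 2) powr p \<le> f x powr p + g x powr p" for x
  proof -
    have "((f x + g x) / 2) powr p \<le> (max (f x) (g x)) powr p"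
      using p Lp_nonnegD(2)[OF f, of x] Lp_nonnegD(2)[OF g, of x] by (intro powr_mono2) auto
    also have "\<dots> \<le> f x powr p + g x powr p" by (auto simp: max_def)
    finally show ?thesis .
  qed
  then have "norm (((f x + g x) / 2) powr p) \<le> norm (f x powr p + g x powr p)" for x
    by simp
  then show "integrable M (\<lambda>x. ((f x + g x) / 2) powr p)"
    by (intro Bochner_Integration.integrable_bound[OF
          Bochner_Integration.integrable_add[OF Lp_nonnegD(3)[OF f] Lp_nonnegD(3)[OF g]]] AE_I2)
       measurable
qed

text \<open>
  Call the integral of \<open>f\<^sup>p\<close> the energy of \<open>f\<close>. The number \<open>c i\<close> plays the role of the capacity of
  the \<open>i\<close>-th set: it almost equals the energy of \<open>u i\<close> and bounds the energy
  of all later midpoints from below, so for large \<open>i\<close> the integrated convexity gap between \<open>u i\<close> and \<open>u j\<close> is small.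
\<close>

lemma minimising_sequence_dominated:
  fixes u :: "nat \<Rightarrow> 'a \<Rightarrow> real"
  assumes p: "1 < p" and u: "\<And>n. u n \<in> Lp_nonneg M p"
    and le: "\<And>n. (\<integral>x. u n x powr p \<partial>M) \<le> c n + 1 / real (Suc n)"
    and mid: "\<And>i j. i \<le> j \<Longrightarrow> c i \<le> (\<integral>x. ((u i x + u j x) / 2) powr p \<partial>M)"
    and c: "c \<longlonglongrightarrow> L" "\<And>n. c n \<le> L" and d: "0 < d"
  obtains g where "g \<in> Lp_nonneg M p" "(\<integral>x. g x powr p \<partial>M) \<le> L + d"
    "\<And>m. \<exists>n\<ge>m. AE x in M. u n x \<le> g x"
proof -
  note int = Lp_nonnegD(3)[OF u]
  have norm_le: "(\<integral>x. u n x powr p \<partial>M) \<le> L + 1 / real (Suc i)" if "i \<le> n" for i n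
  proof -
    have "1 / real (Suc n) \<le> 1 / real (Suc i)" using that by (simp add: frac_le)
    then show ?thesis using le[of n] c(2)[of n] by linarith
  qed
  have Cauchy: "\<exists>N. \<forall>i\<ge>N. \<forall>j\<ge>i. (\<integral>x. \<bar>u j x powr p - u i x powr p\<bar> \<partial>M) \<le> e" if e: "0 < e" for e
  proof -
    have "0 \<le> (\<integral>x. u 0 x powr p \<partial>M)" by (intro Bochner_Integration.integral_nonneg) simp
    also note norm_le[of 0 0]
    finally have L1: "0 \<le> L + 1" by simp
    \<comment> \<open>energies are at most \<open>L + 1\<close>, so the \<open>h\<close>-term below contributes at most \<open>e / 2\<close>\<close>
    define h where "h = min (1/2) (e / (4 * (L + 2)))"
    have h: "0 < h" "h < 1" "h * (2 * (L + 1)) \<le> e / 2"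
    proof -
      show "0 < h" "h < 1" using e L1 by (auto simp: h_def)
      have "h * (2 * (L + 1)) \<le> e / (4 * (L + 2)) * (2 * (L + 2))"
        using e L1 by (intro mult_mono) (auto simp: h_def)
      also have "\<dots> = e / 2" using L1 by (simp add: field_simps)
      finally show "h * (2 * (L + 1)) \<le> e / 2" .
    qed
    obtain K where K: "0 < K" "\<And>a b. 0 \<le> a \<Longrightarrow> 0 \<le> b \<Longrightarrow> \<bar>a powr p - b powr p\<bar>
        \<le> h * (a powr p + b powr p) + K * ((a powr p + b powr p) / 2 - ((a + b) / 2) powr p)"
      using abs_powr_diff_le_midpoint_gap[OF p h(1,2)] by metis
    have "(\<lambda>i. K * (L + 1 / real (Suc i) - c i)) \<longlonglongrightarrow> K * (L + 0 - L)"
      using LIMSEQ_inverse_real_of_nat by (intro tendsto_intros c(1)) (simp add: inverse_eq_divide)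
    then have "\<forall>\<^sub>F i in sequentially. K * (L + 1 / real (Suc i) - c i) < e / 2"
      using e by (intro order_tendstoD(2)) auto
    then obtain N where N: "\<And>i. N \<le> i \<Longrightarrow> K * (L + 1 / real (Suc i) - c i) < e / 2"
      by (auto simp: eventually_sequentially)
    have "(\<integral>x. \<bar>u j x powr p - u i x powr p\<bar> \<partial>M) \<le> e" if ij: "N \<le> i" "i \<le> j" for i j
    proof -
      let ?U = "\<lambda>n. \<integral>x. u n x powr p \<partial>M"
      have average: "(a + b) / 2 - m \<le> q - l" if "l \<le> m" "a \<le> q" "b \<le> q" for a b l m q :: real
        using that by (simp add: field_simps)
      note m = Lp_nonnegD(3)[OF midpoint_in_Lp_nonneg[OF u[of i] u[of j]]]
      have "(\<integral>x. \<bar>u j x powr p - u i x powr p\<bar> \<partial>M)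
          \<le> (\<integral>x. h * (u i x powr p + u j x powr p)
              + K * ((u i x powr p + u j x powr p) / 2 - ((u i x + u j x) / 2) powr p) \<partial>M)"
        using int m p K(2) Lp_nonnegD(2)[OF u]
        by (intro integral_mono) (auto simp: abs_minus_commute)
      also have "\<dots> = h * (?U i + ?U j)
              + K * ((?U i + ?U j) / 2 - (\<integral>x. ((u i x + u j x) / 2) powr p \<partial>M))"
        using int m p by simp
      also have "\<dots> \<le> h * (2 * (L + 1)) + K * (L + 1 / real (Suc i) - c i)"
      proof (intro add_mono mult_left_mono)
        show "?U i + ?U j \<le> 2 * (L + 1)"
          using norm_le[of 0 i] norm_le[of 0 j] by simp
        show "(?U i + ?U j) / 2 - (\<integral>x. ((u i x + u j x) / 2) powr p \<partial>M)
            \<le> L + 1 / real (Suc i) - c i"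
          by (rule average[OF mid[OF ij(2)] norm_le[OF order_refl] norm_le[OF ij(2)]])
      qed (use h K(1) in auto)
      also have "\<dots> \<le> e" using h(3) N[OF ij(1)] by linarith
      finally show ?thesis .
    qed
    then show ?thesis by blast
  qed
  \<comment> \<open>from index \<open>k\<close> on, energies exceed \<open>L\<close> by at most \<open>d / 2\<close>; the majorant costs the other half\<close>
  have "\<forall>\<^sub>F i in sequentially. 1 / real (Suc i) < d / 2"
    using d LIMSEQ_inverse_real_of_nat by (intro order_tendstoD(2)) (auto simp: inverse_eq_divide)
  then obtain k where k: "1 / real (Suc k) < d / 2"
    by (auto simp: eventually_sequentially)
  have Cauchy_tail: "\<exists>N. \<forall>i\<ge>N. \<forall>j\<ge>i.
      (\<integral>x. \<bar>u (j + k) x powr p - u (i + k) x powr p\<bar> \<partial>M) \<le> e" if e: "0 < e" for e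
    using Cauchy[OF e] by (meson add_le_mono1 trans_le_add1)
  have bound: "(\<integral>x. u (n + k) x powr p \<partial>M) \<le> L + d / 2" for n
    using norm_le[of k "n + k"] k by simp
  obtain G where G: "integrable M G" "\<And>x. 0 \<le> G x" "(\<integral>x. G x \<partial>M) \<le> L + d / 2 + d / 2"
      "\<And>m. \<exists>n\<ge>m. AE x in M. u (n + k) x powr p \<le> G x"
    using L1_Cauchy_subsequence_dominated[where F = "\<lambda>n x. u (n + k) x powr p" and M = M,
      OF int _ Cauchy_tail bound, of "d / 2"] d by auto
  have G_powr: "(G x powr (1 / p)) powr p = G x" for x
    using G(2)[of x] p by (simp add: powr_powr)
  show ?thesis
  proof
    have [measurable]: "G \<in> borel_measurable M" using G(1) by auto
    show "(\<lambda>x. G x powr (1 / p)) \<in> Lp_nonneg M p"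
      using G(1) G_powr by (intro Lp_nonnegI) auto
    show "(\<integral>x. (G x powr (1 / p)) powr p \<partial>M) \<le> L + d"
      using G(3) by (simp add: G_powr)
    fix m
    obtain n where n: "n \<ge> m" "AE x in M. u (n + k) x powr p \<le> G x"
      using G(4) by blast
    from n(2) have "AE x in M. u (n + k) x \<le> G x powr (1 / p)"
    proof eventually_elim
      case (elim x)
      then have "(u (n + k) x powr p) powr (1 / p) \<le> G x powr (1 / p)"
        using p by (intro powr_mono2) auto
      then show ?case using p Lp_nonnegD(2)[OF u] by (simp add: powr_powr)
    qed
    then show "\<exists>n\<ge>m. AE x in M. u n x \<le> G x powr (1 / p)"
      using n(1) by (intro exI[of _ "n + k"]) auto
  qed
qed

section \<open>Monotonicity and linearity of the potential\<close>

lemma riesz_potential_mono_AE: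
  assumes "AE x in caratheodory_measure \<mu>. f x \<le> g x"
  shows "riesz_potential \<mu> \<gamma> f x \<le> riesz_potential \<mu> \<gamma> g x"
  unfolding riesz_potential_def using assms
  by (intro nn_integral_mono_AE, eventually_elim)
     (auto intro!: ennreal_leI divide_right_mono mult_right_mono)

lemma sets_borel_le_caratheodory_measure:
  assumes "borel_regular_outer_measure \<mu>"
  shows "sets borel \<subseteq> sets (caratheodory_measure \<mu>)"
  using assms by (auto simp: borel_regular_outer_measure_def sets_caratheodory_measure)

text \<open>
  The measure of the ball is a function of \<open>dist x y\<close>, monotone in it, hence Borel. Finiteness of the balls
  keeps \<open>enn2real\<close> monotone.
\<close>

lemma measurable_ball_dist:
  assumes \<mu>: "borel_regular_outer_measure \<mu>" and fin: "\<And>r. 0 < r \<Longrightarrow> \<mu> (ball x r) < \<infinity>"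
  shows "(\<lambda>y. enn2real (\<mu> (ball x (dist x y)))) \<in> borel_measurable (caratheodory_measure \<mu>)"
proof -
  have oms: "outer_measure_space UNIV \<mu>"
    using \<mu> by (auto simp: borel_regular_outer_measure_def)
  have fin': "\<mu> (ball x r) < \<infinity>" for r
  proof (cases "0 < r")
    case False
    then have "ball x r = {}" by (simp add: ball_eq_empty)
    then show ?thesis
      using oms by (simp only: outer_measure_space_def positive_def) simp
  qed (rule fin)
  have "mono (\<lambda>r. enn2real (\<mu> (ball x r)))"
  proof (intro monoI enn2real_mono)
    fix r s :: real assume "r \<le> s"
    then show "\<mu> (ball x r) \<le> \<mu> (ball x s)"
      using oms by (auto simp: outer_measure_space_def intro!: increasingD[of UNIV \<mu>])
    show "\<mu> (ball x s) < top" using fin'[of s] by simp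
  qed
  then have "(\<lambda>r. enn2real (\<mu> (ball x r))) \<in> borel_measurable borel"
    by (rule borel_measurable_mono)
  moreover have "dist x \<in> borel_measurable (caratheodory_measure \<mu>)"
  proof (rule measurableI)
    fix S :: "real set" assume "S \<in> sets borel"
    moreover have "dist x \<in> borel_measurable borel"
      by (intro borel_measurable_continuous_onI continuous_intros)
    ultimately have "dist x -` S \<in> sets borel"
      by (simp add: measurable_sets_borel)
    then show "dist x -` S \<inter> space (caratheodory_measure \<mu>) \<in> sets (caratheodory_measure \<mu>)"
      using sets_borel_le_caratheodory_measure[OF \<mu>] space_caratheodory_measure[OF oms] by auto
  qed simp
  ultimately show ?thesis by (rule measurable_compose_rev)
qed

lemma riesz_potential_midpoint:
  assumes \<mu>: "borel_regular_outer_measure \<mu>" and fin: "\<And>r. 0 < r \<Longrightarrow> \<mu> (ball x r) < \<infinity>"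
    and f: "f \<in> Lp_nonneg (caratheodory_measure \<mu>) p"
    and g: "g \<in> Lp_nonneg (caratheodory_measure \<mu>) p"
  shows "riesz_potential \<mu> \<gamma> (\<lambda>y. (f y + g y) / 2) x
    = (riesz_potential \<mu> \<gamma> f x + riesz_potential \<mu> \<gamma> g x) / 2"
proof -
  let ?M = "caratheodory_measure \<mu>"
  note [measurable] = measurable_ball_dist[OF \<mu> fin] Lp_nonnegD(1)[OF f] Lp_nonnegD(1)[OF g]
  define w where "w y = enn2real (\<mu> (ball x (dist x y))) powr (1 - \<gamma>)" for y
  have [measurable]: "w \<in> borel_measurable ?M"
    unfolding w_def by measurable
  have w: "0 \<le> w y" for y by (simp add: w_def)
  have [measurable]: "UNIV - {x} \<in> sets ?M"
    using sets_borel_le_caratheodory_measure[OF \<mu>] by auto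
  have "ennreal ((f y + g y) / 2 / w y) = (ennreal (f y / w y) + ennreal (g y / w y)) / 2" for y
  proof -
    have "(f y + g y) / 2 / w y = (f y / w y + g y / w y) / 2"
      by (simp add: add_divide_distrib)
    moreover have "0 \<le> f y / w y" "0 \<le> g y / w y"
      using w Lp_nonnegD(2)[OF f] Lp_nonnegD(2)[OF g] by simp_all
    ultimately show ?thesis
      using divide_ennreal[of "f y / w y + g y / w y" 2] by (simp only: ennreal_plus) simp
  qed
  then have "ennreal ((f y + g y) / 2 / w y) * indicator (UNIV - {x}) y
      = (ennreal (f y / w y) * indicator (UNIV - {x}) y
          + ennreal (g y / w y) * indicator (UNIV - {x}) y) / 2" for y
    by (cases "y = x") simp_all
  then show ?thesis
    unfolding riesz_potential_def w_def[symmetric]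
    by (simp only:) (subst nn_integral_divide, measurable, subst nn_integral_add, measurable)
qed

section \<open>Continuity of the capacity along increasing sets\<close>

lemma riesz_capacity_mono:
  assumes "E \<subseteq> F"
  shows "riesz_capacity \<mu> \<gamma> p E \<le> riesz_capacity \<mu> \<gamma> p F"
  unfolding riesz_capacity_def using assms
  by (intro INF_superset_mono) (auto simp: riesz_admissible_def)

lemma riesz_capacity_le:
  assumes "f \<in> riesz_admissible \<mu> \<gamma> p E" "p \<noteq> 0"
  shows "riesz_capacity \<mu> \<gamma> p E \<le> ennreal (\<integral>x. f x powr p \<partial>caratheodory_measure \<mu>)"
  using assms Lp_norm_powr[of f "caratheodory_measure \<mu>" p]
  by (auto simp: riesz_capacity_def riesz_admissible_def intro!: INF_lower2[of f])

text \<open>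
  Almost minimal functions for the \<open>E n\<close> form a minimising sequence in the sense above, as midpoints
  of \<open>u i\<close> and \<open>u j\<close> remain admissible for the smaller set. The majorant it produces
  is admissible for the union since each of its points lies in all but finitely many \<open>E n\<close>, while
  the majorant dominates infinitely many \<open>u n\<close>.
\<close>

lemma riesz_capacity_incseq_Union:
  assumes \<mu>: "borel_regular_outer_measure \<mu>" and fin: "\<And>x r. 0 < r \<Longrightarrow> \<mu> (ball x r) < \<infinity>"
    and p: "1 < p" and E: "incseq E"
  shows "riesz_capacity \<mu> \<gamma> p (\<Union>n. E n) \<le> (SUP n. riesz_capacity \<mu> \<gamma> p (E n))"
    (is "_ \<le> (SUP n. ?C (E n))")
proof (cases "(SUP n. ?C (E n)) = \<infinity>")
  case False
  let ?M = "caratheodory_measure \<mu>"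
  define c where "c n = enn2real (?C (E n))" for n
  define L where "L = enn2real (SUP n. ?C (E n))"
  have SUP_eq: "(SUP n. ?C (E n)) = ennreal L"
    unfolding L_def using False by (intro ennreal_enn2real[symmetric]) (simp only: less_top infinity_ennreal_def)
  have C_le: "?C (E n) \<le> ennreal L" for n
    using SUP_eq by (metis SUP_upper UNIV_I)
  have C_eq: "?C (E n) = ennreal (c n)" for n
    using le_less_trans[OF C_le ennreal_less_top] by (simp add: c_def)
  have L_nonneg: "0 \<le> L" and c_nonneg: "0 \<le> c n" for n by (simp_all add: L_def c_def)
  have c_le: "c n \<le> L" for n
    using C_le[of n] L_nonneg by (simp add: C_eq)
  have "incseq (\<lambda>n. ?C (E n))"
    using E by (auto simp: incseq_def intro!: riesz_capacity_mono)
  then have "(\<lambda>n. ?C (E n)) \<longlonglongrightarrow> (SUP n. ?C (E n))"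
    by (rule LIMSEQ_SUP)
  then have c_lim: "c \<longlonglongrightarrow> L"
    using L_nonneg c_nonneg unfolding SUP_eq by (simp add: C_eq)
  have "\<exists>f\<in>riesz_admissible \<mu> \<gamma> p (E n). (\<integral>x. f x powr p \<partial>?M) \<le> c n + 1 / real (Suc n)" for n
  proof -
    have "?C (E n) < ennreal (c n + 1 / real (Suc n))"
      using c_nonneg[of n] by (auto simp: C_eq intro!: ennreal_lessI)
    then obtain f where f: "f \<in> riesz_admissible \<mu> \<gamma> p (E n)"
        "ennreal (Lp_norm ?M p f powr p) < ennreal (c n + 1 / real (Suc n))"
      unfolding riesz_capacity_def INF_less_iff by blast
    then have "ennreal (\<integral>x. f x powr p \<partial>?M) \<le> ennreal (c n + 1 / real (Suc n))"
      using p Lp_norm_powr[of f ?M p] by (intro less_imp_le) (auto simp: riesz_admissible_def)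
    then have "(\<integral>x. f x powr p \<partial>?M) \<le> c n + 1 / real (Suc n)"
      using c_nonneg[of n] by (subst (asm) ennreal_le_iff) auto
    with f(1) show ?thesis by blast
  qed
  then obtain u where u: "\<And>n. u n \<in> riesz_admissible \<mu> \<gamma> p (E n)"
      and u_le: "\<And>n. (\<integral>x. u n x powr p \<partial>?M) \<le> c n + 1 / real (Suc n)"
    by metis
  have u_Lp: "u n \<in> Lp_nonneg ?M p" and u_pot: "x \<in> E n \<Longrightarrow> 1 \<le> riesz_potential \<mu> \<gamma> (u n) x" for n x
    using u[of n] by (auto simp: riesz_admissible_def)
  have mid: "c i \<le> (\<integral>x. ((u i x + u j x) / 2) powr p \<partial>?M)" if ij: "i \<le> j" for i j
  proof -
    have "(\<lambda>x. (u i x + u j x) / 2) \<in> riesz_admissible \<mu> \<gamma> p (E i)"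
      unfolding riesz_admissible_def
    proof (intro CollectI conjI ballI)
      show "(\<lambda>x. (u i x + u j x) / 2) \<in> Lp_nonneg ?M p"
        using p by (intro midpoint_in_Lp_nonneg u_Lp) auto
      fix x assume x: "x \<in> E i"
      then have "x \<in> E j" using E ij by (auto simp: incseq_def)
      with x have "1 + 1 \<le> riesz_potential \<mu> \<gamma> (u i) x + riesz_potential \<mu> \<gamma> (u j) x"
        by (intro add_mono u_pot)
      then have "(1 + 1) / 2 \<le> (riesz_potential \<mu> \<gamma> (u i) x + riesz_potential \<mu> \<gamma> (u j) x) / 2"
        by (rule divide_right_mono_ennreal)
      then show "1 \<le> riesz_potential \<mu> \<gamma> (\<lambda>x. (u i x + u j x) / 2) x"
        by (subst riesz_potential_midpoint[OF \<mu> fin u_Lp u_Lp]) auto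
    qed
    from riesz_capacity_le[OF this] p show ?thesis
      by (simp add: C_eq)
  qed
  show ?thesis
  proof (rule ennreal_le_epsilon)
    fix d :: real assume d: "0 < d"
    obtain g where g: "g \<in> Lp_nonneg ?M p" "(\<integral>x. g x powr p \<partial>?M) \<le> L + d"
        "\<And>m. \<exists>n\<ge>m. AE x in ?M. u n x \<le> g x"
      using minimising_sequence_dominated[OF p u_Lp u_le mid c_lim c_le d] by auto
    have "g \<in> riesz_admissible \<mu> \<gamma> p (\<Union>n. E n)"
      unfolding riesz_admissible_def
    proof (intro CollectI conjI ballI g(1))
      fix x assume "x \<in> (\<Union>n. E n)"
      then obtain m where m: "x \<in> E m" by blast
      obtain n where n: "m \<le> n" "AE y in ?M. u n y \<le> g y" using g(3) by blast
      have "x \<in> E n" using m n(1) E by (auto simp: incseq_def)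
      then have "1 \<le> riesz_potential \<mu> \<gamma> (u n) x" by (rule u_pot)
      also have "\<dots> \<le> riesz_potential \<mu> \<gamma> g x"
        using n(2) by (rule riesz_potential_mono_AE)
      finally show "1 \<le> riesz_potential \<mu> \<gamma> g x" .
    qed
    from riesz_capacity_le[OF this] p
    have "?C (\<Union>n. E n) \<le> ennreal (\<integral>x. g x powr p \<partial>?M)" by simp
    also have "\<dots> \<le> ennreal (L + d)" using g(2) by (rule ennreal_leI)
    also have "\<dots> = (SUP n. ?C (E n)) + ennreal d"
      using L_nonneg d by (simp add: SUP_eq)
    finally show "?C (\<Union>n. E n) \<le> (SUP n. ?C (E n)) + ennreal d" .
  qed
next
  case True
  then show ?thesis by (simp only: infinity_ennreal_def top_greatest)
qed

theorem corollary3p13: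
  fixes \<mu> :: "'a::metric_space set \<Rightarrow> ennreal"
    and p \<gamma> :: real
    and A :: "nat \<Rightarrow> 'a set"
  assumes "doubling_space \<mu>"
    and "1 < p"
    and "0 < \<gamma>" and "\<gamma> < 1"
  shows "riesz_capacity \<mu> \<gamma> p (\<Union>j\<in>{1..}. \<Inter>k\<in>{j..}. A k)
           \<le> liminf (\<lambda>i. riesz_capacity \<mu> \<gamma> p (A i))"
proof -
  interpret doubling_space \<mu> by fact
  define E where "E j = (\<Inter>k\<in>{j..}. A k)" for j
  have "riesz_capacity \<mu> \<gamma> p (\<Union>j\<in>{1..}. E j) \<le> riesz_capacity \<mu> \<gamma> p (\<Union>j. E j)"
    by (rule riesz_capacity_mono) auto
  also have "\<dots> \<le> (SUP j. riesz_capacity \<mu> \<gamma> p (E j))"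
    by (rule riesz_capacity_incseq_Union[OF borel_regular ball_finite \<open>1 < p\<close>])
       (auto simp: E_def incseq_def)
  also have "\<dots> \<le> (SUP j. INF k\<in>{j..}. riesz_capacity \<mu> \<gamma> p (A k))"
    by (intro SUP_mono' INF_greatest riesz_capacity_mono) (auto simp: E_def)
  also have "\<dots> = liminf (\<lambda>i. riesz_capacity \<mu> \<gamma> p (A i))"
    by (rule liminf_SUP_INF[symmetric])
  finally show ?thesis by (simp add: E_def)
qed

end
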